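(* Let $n\ge 3$, let $z_1,\dots,z_n$ be non-negative integers (not necessarily distinct), let $X$ be the set of all $n$-tuples obtained by permuting the coordinates of $(z_1,\dots,z_n)$, and let $V$ be a complex vector space with orthonormal basis $\beta=\{v_x : x\in X\}$. For all values $a,b$ that occur as consecutive coordinates $(x_k,x_{k+1})=(a,b)$ of some $x\in X$, let $q_{a,b}$ be a non-zero complex number. For $1\le k\le n-1$ define the linear operator $\phi(\tau_k)$ on $V$ by $$\phi(\tau_k)(v_x)=q_{x_k,x_{k+1}}\,v_{\sigma_k(x)}\qquad (x\in X),$$ where $\sigma_k(x_1,\dots,x_n)=(x_1,\dots,x_{k-1},x_{k+1},x_k,x_{k+2},\dots,x_n)$. Then $(\phi,V)$ is a representation of the braid group $\mathbb{B}_n$; that is, the assignment $\tau_k\mapsto\phi(\tau_k)$ defines a group homomorphism $\phi:\mathbb{B}_n\to\operatorname{Aut}(V)$.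
   Context: The braid group $\mathbb{B}_n$ on $n$ strings is the group with generators $\tau_1,\dots,\tau_{n-1}$ and relations $\tau_k\tau_j=\tau_j\tau_k$ if $|k-j|>1$, and $\tau_k\tau_{k+1}\tau_k=\tau_{k+1}\tau_k\tau_{k+1}$ for $1\le k\le n-2$. A (finite dimensional complex) representation of $\mathbb{B}_n$ is a pair $(\phi,V)$ where $V$ is a finite dimensional complex vector space and $\phi:\mathbb{B}_n\to\operatorname{Aut}(V)$ is a group homomorphism, $\operatorname{Aut}(V)$ being the group of invertible linear maps of $V$. Here $\dim V=|X|$. The number $q_{x_k,x_{k+1}}$ depends only on the ordered pair of values $(x_k,x_{k+1})$, so it is $q_{a,b}$ with $a=x_k$, $b=x_{k+1}$. *)

theory Defs
  imports Complex_Main "HOL-Algebra.Group" "HOL-Combinatorics.List_Permutation"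
begin

section \<open>Groups given by generators and relations\<close>

text \<open>The letter \<open>(g, True)\<close> stands for the generator \<open>g\<close> and \<open>(g, False)\<close> for its formal inverse.\<close>

type_synonym 'g word = "('g \<times> bool) list"

definition words :: "'g set \<Rightarrow> 'g word set" where
  "words S = lists (S \<times> UNIV)"

text \<open>A pair \<open>(u, v)\<close> in \<open>R\<close> is the relation \<open>u = v\<close>.\<close>

inductive pres_eq :: "'g set \<Rightarrow> ('g word \<times> 'g word) set \<Rightarrow> 'g word \<Rightarrow> 'g word \<Rightarrow> bool"
  for S :: "'g set" and R :: "('g word \<times> 'g word) set"
where
  refl: "u \<in> words S \<Longrightarrow> pres_eq S R u u"
| sym: "pres_eq S R u v \<Longrightarrow> pres_eq S R v u"
| trans: "pres_eq S R u v \<Longrightarrow> pres_eq S R v w \<Longrightarrow> pres_eq S R u w"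
| mult: "pres_eq S R u u' \<Longrightarrow> pres_eq S R v v' \<Longrightarrow> pres_eq S R (u @ v) (u' @ v')"
| cancel: "g \<in> S \<Longrightarrow> pres_eq S R [(g, b), (g, \<not> b)] []"
| rel: "(u, v) \<in> R \<Longrightarrow> u \<in> words S \<Longrightarrow> v \<in> words S \<Longrightarrow> pres_eq S R u v"

definition word_class :: "'g set \<Rightarrow> ('g word \<times> 'g word) set \<Rightarrow> 'g word \<Rightarrow> 'g word set" where
  "word_class S R u = {v. pres_eq S R u v}"

definition presented_group :: "'g set \<Rightarrow> ('g word \<times> 'g word) set \<Rightarrow> 'g word set monoid" where
  "presented_group S R =
     \<lparr>carrier = word_class S R ` words S,
      monoid.mult = (\<lambda>A B. \<Union>u\<in>A. \<Union>v\<in>B. word_class S R (u @ v)),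
      one = word_class S R []\<rparr>"

lemma pres_eq_words: "pres_eq S R u v \<Longrightarrow> u \<in> words S \<and> v \<in> words S"
  by (induction rule: pres_eq.induct) (auto simp: words_def)

lemma word_class_eq_iff:
  assumes "u \<in> words S"
  shows "word_class S R u = word_class S R v \<longleftrightarrow> pres_eq S R u v"
proof
  assume "word_class S R u = word_class S R v"
  moreover have "u \<in> word_class S R u"
    using assms by (simp add: word_class_def pres_eq.refl)
  ultimately have "pres_eq S R v u" by (simp add: word_class_def)
  then show "pres_eq S R u v" by (rule pres_eq.sym)
next
  assume uv: "pres_eq S R u v"
  have "pres_eq S R u w \<longleftrightarrow> pres_eq S R v w" for w
    using pres_eq.trans[OF uv] pres_eq.trans[OF pres_eq.sym[OF uv]] by blast
  then show "word_class S R u = word_class S R v" by (simp add: word_class_def)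
qed

lemma presented_group_mult:
  assumes "u \<in> words S" "v \<in> words S"
  shows "word_class S R u \<otimes>\<^bsub>presented_group S R\<^esub> word_class S R v = word_class S R (u @ v)"
proof -
  have "word_class S R (u' @ v') = word_class S R (u @ v)"
    if "u' \<in> word_class S R u" "v' \<in> word_class S R v" for u' v'
  proof -
    have e: "pres_eq S R (u @ v) (u' @ v')"
      using that by (auto simp: word_class_def intro: pres_eq.mult)
    then have "word_class S R (u @ v) = word_class S R (u' @ v')"
      using word_class_eq_iff pres_eq_words by blast
    then show ?thesis by simp
  qed
  then have "(\<Union>u'\<in>word_class S R u. \<Union>v'\<in>word_class S R v. word_class S R (u' @ v')) =
      (\<Union>u'\<in>word_class S R u. \<Union>v'\<in>word_class S R v. word_class S R (u @ v))"
    by (intro SUP_cong HOL.refl)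
  also have "\<dots> = word_class S R (u @ v)"
  proof -
    have "u \<in> word_class S R u" "v \<in> word_class S R v"
      using assms by (simp_all add: word_class_def pres_eq.refl)
    then show ?thesis by blast
  qed
  finally show ?thesis by (simp add: presented_group_def)
qed

lemma pres_eq_left_inverse:
  assumes "u \<in> words S"
  shows "pres_eq S R (rev (map (\<lambda>(g, b). (g, \<not> b)) u) @ u) []"
  using assms
proof (induction u)
  case Nil
  then show ?case by (simp add: pres_eq.refl words_def)
next
  case (Cons a u)
  obtain g b where a: "a = (g, b)" by (cases a)
  have g: "g \<in> S" and u: "u \<in> words S"
    using Cons.prems a by (auto simp: words_def)
  let ?i = "rev (map (\<lambda>(g, b). (g, \<not> b)) u)"
  have i: "?i \<in> words S" using u by (auto simp: words_def)
  have "pres_eq S R [(g, \<not> b), (g, b)] []"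
    using pres_eq.cancel[of g S R "\<not> b"] g by simp
  then have "pres_eq S R (?i @ ([(g, \<not> b), (g, b)] @ u)) (?i @ ([] @ u))"
    by (intro pres_eq.mult pres_eq.refl i u)
  then have "pres_eq S R (?i @ ([(g, \<not> b), (g, b)] @ u)) []"
    using pres_eq.trans[OF _ Cons.IH[OF u]] by simp
  then show ?case by (simp add: a)
qed

lemma group_presented_group: "group (presented_group S R)"
proof (rule groupI)
  let ?G = "presented_group S R"
  have car: "carrier ?G = word_class S R ` words S" and
    one: "\<one>\<^bsub>?G\<^esub> = word_class S R []"
    by (simp_all add: presented_group_def)
  have nil: "[] \<in> words S" by (simp add: words_def)
  have app: "u @ v \<in> words S" if "u \<in> words S" "v \<in> words S" for u v
    using that by (auto simp: words_def)
  show "\<one>\<^bsub>?G\<^esub> \<in> carrier ?G" using nil by (simp add: car one)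
  show "x \<otimes>\<^bsub>?G\<^esub> y \<in> carrier ?G" if "x \<in> carrier ?G" "y \<in> carrier ?G" for x y
    using that app by (auto simp: car presented_group_mult)
  show "x \<otimes>\<^bsub>?G\<^esub> y \<otimes>\<^bsub>?G\<^esub> z = x \<otimes>\<^bsub>?G\<^esub> (y \<otimes>\<^bsub>?G\<^esub> z)"
    if "x \<in> carrier ?G" "y \<in> carrier ?G" "z \<in> carrier ?G" for x y z
    using that app by (auto simp: car presented_group_mult)
  show "\<one>\<^bsub>?G\<^esub> \<otimes>\<^bsub>?G\<^esub> x = x" if "x \<in> carrier ?G" for x
    using that nil by (auto simp: car one presented_group_mult)
  show "\<exists>y\<in>carrier ?G. y \<otimes>\<^bsub>?G\<^esub> x = \<one>\<^bsub>?G\<^esub>" if x: "x \<in> carrier ?G" for x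
  proof -
    obtain u where u: "u \<in> words S" "x = word_class S R u" using x car by auto
    let ?i = "rev (map (\<lambda>(g, b). (g, \<not> b)) u)"
    have i: "?i \<in> words S" using u by (auto simp: words_def)
    have "word_class S R ?i \<otimes>\<^bsub>?G\<^esub> x = \<one>\<^bsub>?G\<^esub>"
      using pres_eq_left_inverse[OF u(1)] app[OF i u(1)]
      by (simp add: u(2) presented_group_mult[OF i u(1)] one word_class_eq_iff)
    then show ?thesis using i car by blast
  qed
qed

section \<open>The braid group\<close>

definition braid_relations :: "nat \<Rightarrow> (nat word \<times> nat word) set" where
  "braid_relations n =
     {([(k, True), (j, True)], [(j, True), (k, True)]) | k j.
        k \<in> {1..n - 1} \<and> j \<in> {1..n - 1} \<and> \<bar>int k - int j\<bar> > 1} \<union>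
     {([(k, True), (k + 1, True), (k, True)], [(k + 1, True), (k, True), (k + 1, True)]) | k.
        k \<in> {1..n - 2}}"

definition braid_group :: "nat \<Rightarrow> nat word set monoid" where
  "braid_group n = presented_group {1..n - 1} (braid_relations n)"

definition braid_gen :: "nat \<Rightarrow> nat \<Rightarrow> nat word set" where
  "braid_gen n k = word_class {1..n - 1} (braid_relations n) [(k, True)]"

lemma group_braid_group: "group (braid_group n)"
  by (simp add: braid_group_def group_presented_group)

lemma braid_gen_in_carrier: "k \<in> {1..n - 1} \<Longrightarrow> braid_gen n k \<in> carrier (braid_group n)"
  by (auto simp: braid_group_def braid_gen_def presented_group_def words_def)

section \<open>Representations on complex vector spaces\<close>

definition Aut_group :: "(complex \<Rightarrow> 'v \<Rightarrow> 'v::ab_group_add) \<Rightarrow> ('v \<Rightarrow> 'v) monoid" where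
  "Aut_group scale =
     \<lparr>carrier = {f. Vector_Spaces.linear scale scale f \<and> bij f},
      monoid.mult = (\<circ>),
      one = id\<rparr>"

lemma group_Aut_group:
  assumes "vector_space (scale :: complex \<Rightarrow> 'v \<Rightarrow> 'v::ab_group_add)"
  shows "group (Aut_group scale)"
proof (rule groupI)
  interpret V: vector_space scale by (rule assms)
  interpret VV: vector_space_pair scale scale ..
  show "\<one>\<^bsub>Aut_group scale\<^esub> \<in> carrier (Aut_group scale)"
    by (simp add: Aut_group_def V.linear_id)
  show "f \<otimes>\<^bsub>Aut_group scale\<^esub> g \<in> carrier (Aut_group scale)"
    if "f \<in> carrier (Aut_group scale)" "g \<in> carrier (Aut_group scale)" for f g
    using that by (auto simp: Aut_group_def bij_comp intro: Vector_Spaces.linear_compose)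
  show "\<exists>g\<in>carrier (Aut_group scale). g \<otimes>\<^bsub>Aut_group scale\<^esub> f = \<one>\<^bsub>Aut_group scale\<^esub>"
    if "f \<in> carrier (Aut_group scale)" for f
  proof -
    have lin: "Vector_Spaces.linear scale scale f" and b: "bij f"
      using that by (auto simp: Aut_group_def)
    obtain g where g: "Vector_Spaces.linear scale scale g" "g \<circ> f = id"
      using VV.linear_injective_left_inverse[OF lin bij_is_inj[OF b]] by blast
    have "g = inv_into UNIV f"
    proof
      fix y
      have "g (f (inv_into UNIV f y)) = inv_into UNIV f y" using g(2) by (simp add: fun_eq_iff)
      then show "g y = inv_into UNIV f y" using b by (simp add: bij_is_surj surj_f_inv_f)
    qed
    then have "bij g" using b by (simp add: bij_imp_bij_inv)
    then show ?thesis using g by (auto simp: Aut_group_def)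
  qed
qed (auto simp: Aut_group_def)

definition fd_representation ::
  "('g, 'm) monoid_scheme \<Rightarrow> (complex \<Rightarrow> 'v \<Rightarrow> 'v::ab_group_add) \<Rightarrow> ('g \<Rightarrow> 'v \<Rightarrow> 'v) \<Rightarrow> bool" where
  "fd_representation G scale \<phi> \<longleftrightarrow>
     vector_space scale \<and> (\<exists>B. finite B \<and> module.span scale B = UNIV) \<and>
     \<phi> \<in> hom G (Aut_group scale)"

text \<open>The distribution has only real inner product spaces.\<close>

locale complex_inner_space = vector_space scale
  for scale :: "complex \<Rightarrow> 'v \<Rightarrow> 'v::ab_group_add" +
  fixes ip :: "'v \<Rightarrow> 'v \<Rightarrow> complex"
  assumes ip_add_left: "ip (u + v) w = ip u w + ip v w"
    and ip_scale_left: "ip (scale c u) v = c * ip u v"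
    and ip_commute: "ip u v = cnj (ip v u)"
    and ip_pos: "u \<noteq> 0 \<Longrightarrow> Re (ip u u) > 0"

definition (in complex_inner_space) orthonormal_basis :: "'i set \<Rightarrow> ('i \<Rightarrow> 'v) \<Rightarrow> bool" where
  "orthonormal_basis I v \<longleftrightarrow>
     inj_on v I \<and> independent (v ` I) \<and> span (v ` I) = UNIV \<and>
     (\<forall>i\<in>I. \<forall>j\<in>I. ip (v i) (v j) = (if i = j then 1 else 0))"

section \<open>Tuples\<close>

definition rearrangements :: "'a list \<Rightarrow> 'a list set" where
  "rearrangements z = {permute_list p z | p. p permutes {..<length z}}"

text \<open>Coordinates of tuples are numbered from 1, list positions from 0.\<close>

definition coord :: "'a list \<Rightarrow> nat \<Rightarrow> 'a" where
  "coord x k = x ! (k - 1)"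

definition swap_adj :: "nat \<Rightarrow> 'a list \<Rightarrow> 'a list" where
  "swap_adj k x = x[k - 1 := coord x (k + 1), k := coord x k]"

end

theory Submission
  imports Defs
begin

section \<open>The universal property of a presented group\<close>

text \<open>A homomorphism out of a presented group amounts to a choice of images of the generators
  that satisfies the relations (\<open>presented_group_hom_exists\<close>,
  \<open>presented_group_hom_unique\<close>); \<open>word_eval\<close> multiplies out a word in the
  target group. So it suffices to produce the operators \<open>T k\<close> and to test them on the
  basis. Each exists because a linear map may be prescribed on a basis, and for \<open>k\<close> in
  the index range it is invertible because it permutes the basis by an involution, up to non-zero
  scalars (\<open>bij_weighted_basis_involution\<close>).

  Each relation splits into an identity of tuples (\<open>swap_adj_commute\<close>,
  \<open>swap_adj_braid\<close>) and an identity of scalars. If \<open>k\<close> and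
  \<open>j\<close> are far apart, neither swap touches the coordinates that the other factor reads.
  In the braid relation, starting from entries a, b, c, either side lets each of the pairs (a, b),
  (a, c), (b, c) cross exactly once, so both collect the same three factors and only their order
  differs.\<close>

primrec word_eval :: "('a, 'm) monoid_scheme \<Rightarrow> ('g \<Rightarrow> 'a) \<Rightarrow> 'g word \<Rightarrow> 'a" where
  "word_eval H f [] = \<one>\<^bsub>H\<^esub>"
| "word_eval H f (a # u) = (if snd a then f (fst a) else inv\<^bsub>H\<^esub> f (fst a)) \<otimes>\<^bsub>H\<^esub> word_eval H f u"

lemma word_eval_closed:
  assumes "group H" and "f \<in> S \<rightarrow> carrier H" and "u \<in> words S"
  shows "word_eval H f u \<in> carrier H"
proof -
  interpret H: group H by (rule assms)
  show ?thesis
    using assms(3)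
  proof (induction u)
    case (Cons a u)
    then have "f (fst a) \<in> carrier H" "u \<in> words S"
      using assms(2) by (auto simp: words_def)
    then show ?case using Cons.IH by simp
  qed simp
qed

lemma word_eval_append:
  assumes "group H" and "f \<in> S \<rightarrow> carrier H" and "u \<in> words S" and "w \<in> words S"
  shows "word_eval H f (u @ w) = word_eval H f u \<otimes>\<^bsub>H\<^esub> word_eval H f w"
proof -
  interpret H: group H by (rule assms)
  note closed = word_eval_closed[OF assms(1,2)]
  show ?thesis
    using assms(3)
  proof (induction u)
    case Nil
    then show ?case using closed[OF assms(4)] by simp
  next
    case (Cons a u)
    then have u: "u \<in> words S" and a: "f (fst a) \<in> carrier H"
      using assms(2) by (auto simp: words_def)
    show ?case
      using Cons.IH[OF u] a closed[OF u] closed[OF assms(4)] by (simp add: H.m_assoc)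
  qed
qed

text \<open>Every rule generating the congruence except \<open>rel\<close> holds in any group:
  \<open>cancel\<close> is the inverse law and \<open>mult\<close> follows from
  \<open>word_eval_append\<close>. Hence only the defining relations have to be checked in
  \<open>H\<close>.\<close>

lemma word_eval_pres_eq:
  assumes "group H" and "f \<in> S \<rightarrow> carrier H"
    and rel: "\<And>u w. (u, w) \<in> R \<Longrightarrow> u \<in> words S \<Longrightarrow> w \<in> words S \<Longrightarrow>
      word_eval H f u = word_eval H f w"
    and "pres_eq S R u w"
  shows "word_eval H f u = word_eval H f w"
proof -
  interpret H: group H by (rule assms)
  show ?thesis
    using assms(4)
  proof (induction rule: pres_eq.induct)
    case (mult u u' w w')
    then show ?case
      using word_eval_append[OF assms(1,2)] pres_eq_words by metis
  next
    case (cancel g b)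
    then have "f g \<in> carrier H" using assms(2) by auto
    then show ?case by simp
  qed (simp_all add: rel)
qed

lemma carrier_presented_group: "carrier (presented_group S R) = word_class S R ` words S"
  by (simp add: presented_group_def)

text \<open>Existence half of the universal property. Extensionality fixes the values off the
  carrier, so that the homomorphism can be unique as a total function.\<close>

lemma presented_group_hom_exists:
  assumes "group H" and "f \<in> S \<rightarrow> carrier H"
    and "\<And>u w. (u, w) \<in> R \<Longrightarrow> u \<in> words S \<Longrightarrow> w \<in> words S \<Longrightarrow>
      word_eval H f u = word_eval H f w"
  obtains h where "h \<in> hom (presented_group S R) H"
    and "h \<in> extensional (carrier (presented_group S R))"
    and "\<And>g. g \<in> S \<Longrightarrow> h (word_class S R [(g, True)]) = f g"
proof -
  interpret H: group H by (rule assms)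
  let ?G = "presented_group S R"
  \<comment> \<open>A class is evaluated at an arbitrary representative;
    \<open>word_eval_pres_eq\<close> makes the choice irrelevant.\<close>
  define h where
    "h = restrict (\<lambda>A. word_eval H f (SOME u. u \<in> words S \<and> A = word_class S R u)) (carrier ?G)"
  have h: "h (word_class S R u) = word_eval H f u" if u: "u \<in> words S" for u
  proof -
    define w where "w = (SOME w. w \<in> words S \<and> word_class S R u = word_class S R w)"
    have "w \<in> words S \<and> word_class S R u = word_class S R w"
      unfolding w_def by (rule someI[of _ u]) (simp add: u)
    then have "pres_eq S R u w"
      using word_class_eq_iff[OF u] by blast
    then have "word_eval H f w = word_eval H f u"
      using word_eval_pres_eq[OF assms(1,2,3)] by metis
    then show ?thesis
      using u by (simp add: h_def w_def carrier_presented_group)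
  qed
  have app: "u @ w \<in> words S" if "u \<in> words S" "w \<in> words S" for u w
    using that by (auto simp: words_def)
  show thesis
  proof
    show "h \<in> hom ?G H"
      by (rule homI)
        (auto simp: carrier_presented_group h presented_group_mult app
          word_eval_append[OF assms(1,2)] word_eval_closed[OF assms(1,2)])
    show "h \<in> extensional (carrier ?G)" by (simp add: h_def)
    show "h (word_class S R [(g, True)]) = f g" if "g \<in> S" for g
    proof -
      have "f g \<in> carrier H" using that assms(2) by auto
      then show ?thesis using that by (simp add: h words_def)
    qed
  qed
qed

text \<open>The classes of positive letters generate the group: a negative letter is the inverse of
  a positive one, and every word is a product of letters.\<close>

lemma presented_group_hom_unique:
  assumes "group H"
    and "h \<in> hom (presented_group S R) H" and "h' \<in> hom (presented_group S R) H"
    and gen: "\<And>g. g \<in> S \<Longrightarrow> h (word_class S R [(g, True)]) = h' (word_class S R [(g, True)])"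
    and "A \<in> carrier (presented_group S R)"
  shows "h A = h' A"
proof -
  let ?G = "presented_group S R"
  interpret h: group_hom ?G H h
    using assms by (simp add: group_hom_def group_hom_axioms_def group_presented_group)
  interpret h': group_hom ?G H h'
    using assms by (simp add: group_hom_def group_hom_axioms_def group_presented_group)
  have one: "\<one>\<^bsub>?G\<^esub> = word_class S R []" by (simp add: presented_group_def)
  have car: "word_class S R u \<in> carrier ?G" if "u \<in> words S" for u
    using that by (simp add: carrier_presented_group)
  have letter: "h (word_class S R [(g, b)]) = h' (word_class S R [(g, b)])" if g: "g \<in> S" for g b
  proof (cases b)
    case True
    then show ?thesis using gen g by simp
  next
    case False
    have w: "[(g, c)] \<in> words S" for c using g by (simp add: words_def)
    have "word_class S R [(g, False)] \<otimes>\<^bsub>?G\<^esub> word_class S R [(g, True)] = \<one>\<^bsub>?G\<^esub>"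
      using pres_eq.cancel[OF g, of R False] g
      by (simp add: presented_group_mult w one word_class_eq_iff words_def)
    then have "inv\<^bsub>?G\<^esub> word_class S R [(g, True)] = word_class S R [(g, False)]"
      by (rule h.G.inv_equality) (simp_all add: car w)
    then show ?thesis
      using h.hom_inv[OF car[OF w[of True]]] h'.hom_inv[OF car[OF w[of True]]] gen[OF g] False
      by simp
  qed
  have "h (word_class S R u) = h' (word_class S R u)" if "u \<in> words S" for u
    using that
  proof (induction u)
    case Nil
    show ?case using h.hom_one h'.hom_one by (simp add: one)
  next
    case (Cons a u)
    obtain g b where a: "a = (g, b)" by (cases a)
    have g: "g \<in> S" and u: "u \<in> words S" and w: "[(g, b)] \<in> words S"
      using Cons.prems a by (auto simp: words_def)
    have "word_class S R (a # u) = word_class S R [(g, b)] \<otimes>\<^bsub>?G\<^esub> word_class S R u"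
      by (simp add: presented_group_mult w u a)
    then show ?case
      using h.hom_mult[OF car[OF w] car[OF u]] h'.hom_mult[OF car[OF w] car[OF u]]
        letter[OF g] Cons.IH[OF u] by simp
  qed
  then show ?thesis using assms(5) by (auto simp: carrier_presented_group)
qed

section \<open>Operators that permute a basis up to scalars\<close>

lemma (in vector_space) linear_eq_on_basis:
  assumes "Vector_Spaces.linear scale scale f" and "Vector_Spaces.linear scale scale g"
    and "span B = UNIV" and "\<And>b. b \<in> B \<Longrightarrow> f b = g b"
  shows "f = g"
proof
  interpret P: vector_space_pair scale scale ..
  show "f x = g x" for x
    using P.linear_eq_on[OF assms(1,2)] assms(3,4) by blast
qed

text \<open>Injectivity of \<open>v\<close> on \<open>X\<close> lets the index \<open>x\<close> be
  recovered from the vector \<open>v x\<close>, so the prescribed values are well defined.\<close>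

lemma (in vector_space) linear_weighted_basis_map_exists:
  assumes "inj_on v X" and "independent (v ` X)"
  obtains T where "Vector_Spaces.linear scale scale T"
    and "\<And>x. x \<in> X \<Longrightarrow> T (v x) = scale (c x) (v (s x))"
proof -
  interpret P: vector_space_pair scale scale ..
  obtain T where "Vector_Spaces.linear scale scale T"
    and "\<forall>b\<in>v ` X. T b = scale (c (inv_into X v b)) (v (s (inv_into X v b)))"
    using P.linear_independent_extend[OF assms(2),
        of "\<lambda>b. scale (c (inv_into X v b)) (v (s (inv_into X v b)))"] by blast
  then show thesis
    using that assms(1) by simp
qed

lemma (in vector_space) bij_weighted_basis_involution:
  assumes basis: "inj_on v X" "independent (v ` X)" "span (v ` X) = UNIV"
    and s: "\<And>x. x \<in> X \<Longrightarrow> s x \<in> X" "\<And>x. x \<in> X \<Longrightarrow> s (s x) = x"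
    and c: "\<And>x. x \<in> X \<Longrightarrow> c x \<noteq> 0"
    and T: "Vector_Spaces.linear scale scale T"
      "\<And>x. x \<in> X \<Longrightarrow> T (v x) = scale (c x) (v (s x))"
  shows "bij T"
proof -
  interpret T: Vector_Spaces.linear scale scale T by (rule T)
  \<comment> \<open>The inverse must send \<open>v (s x)\<close> back to \<open>v x\<close> divided
    by \<open>c x\<close>; replacing \<open>x\<close> by \<open>s x\<close> gives this
    formula.\<close>
  obtain U where U: "Vector_Spaces.linear scale scale U"
    "\<And>x. x \<in> X \<Longrightarrow> U (v x) = scale (inverse (c (s x))) (v (s x))"
    using linear_weighted_basis_map_exists[OF basis(1,2), of "\<lambda>x. inverse (c (s x))" s] by metis
  interpret U: Vector_Spaces.linear scale scale U by (rule U)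
  have "T \<circ> U = id"
    by (rule linear_eq_on_basis[OF Vector_Spaces.linear_compose[OF U(1) T(1)] linear_id basis(3)])
      (auto simp: U T.scale T s c)
  moreover have "U \<circ> T = id"
    by (rule linear_eq_on_basis[OF Vector_Spaces.linear_compose[OF T(1) U(1)] linear_id basis(3)])
      (auto simp: U U.scale T s c)
  ultimately show ?thesis
    by (rule o_bij[rotated])
qed

section \<open>Adjacent transpositions of tuples\<close>

text \<open>In terms of multisets, closure under swaps and constancy of the length become
  immediate.\<close>

lemma rearrangements_eq_mset: "rearrangements z = {x. mset x = mset z}"
proof (intro equalityI subsetI)
  fix x assume "x \<in> {x. mset x = mset z}"
  then have "mset x = mset z" by simp
  then obtain p where "p permutes {..<length z}" "permute_list p z = x"
    by (rule mset_eq_permutation)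
  then show "x \<in> rearrangements z" by (auto simp: rearrangements_def)
qed (auto simp: rearrangements_def)

lemma finite_rearrangements: "finite (rearrangements z)"
  by (simp add: rearrangements_def finite_permutations setcompr_eq_image)

lemma length_swap_adj [simp]: "length (swap_adj k x) = length x"
  by (simp add: swap_adj_def)

text \<open>Swapping composes the tuple with the transposition of \<open>k\<close> and
  \<open>k + 1\<close>, so identities between swaps become case distinctions on the index
  \<open>j\<close>.\<close>

lemma coord_swap_adj:
  assumes "k \<in> {1..length x - 1}" and "j \<in> {1..length x}"
  shows "coord (swap_adj k x) j = coord x (if j = k then k + 1 else if j = k + 1 then k else j)"
  using assms by (auto simp: swap_adj_def coord_def nth_list_update)

lemma swap_adj_in_rearrangements:
  assumes "x \<in> rearrangements z" and "k \<in> {1..length z - 1}"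
  shows "swap_adj k x \<in> rearrangements z"
proof -
  have m: "mset x = mset z" using assms(1) by (simp add: rearrangements_eq_mset)
  then have "length x = length z" by (rule mset_eq_length)
  then show ?thesis
    using assms(2) m mset_swap[of k x "k - 1"]
    by (auto simp: rearrangements_eq_mset swap_adj_def coord_def)
qed

lemma tuple_eqI:
  assumes "length x = length y" and "\<And>j. j \<in> {1..length x} \<Longrightarrow> coord x j = coord y j"
  shows "x = y"
proof (rule nth_equalityI)
  show "x ! i = y ! i" if "i < length x" for i
    using assms(2)[of "Suc i"] that by (simp add: coord_def)
qed (rule assms)

lemma swap_adj_swap_adj:
  assumes "k \<in> {1..length x - 1}"
  shows "swap_adj k (swap_adj k x) = x"
  using assms by (intro tuple_eqI) (auto simp: coord_swap_adj)

lemma swap_adj_commute: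
  assumes "k \<in> {1..length x - 1}" and "j \<in> {1..length x - 1}" and "\<bar>int k - int j\<bar> > 1"
  shows "swap_adj k (swap_adj j x) = swap_adj j (swap_adj k x)"
  using assms by (intro tuple_eqI) (auto simp: coord_swap_adj)

text \<open>Both sides reverse the three entries at \<open>k\<close>, \<open>k + 1\<close>,
  \<open>k + 2\<close>.\<close>

lemma swap_adj_braid:
  assumes "k \<in> {1..length x - 2}"
  shows "swap_adj k (swap_adj (k + 1) (swap_adj k x)) =
    swap_adj (k + 1) (swap_adj k (swap_adj (k + 1) x))"
proof -
  have "k \<in> {1..length x - 1}" "k + 1 \<in> {1..length x - 1}" using assms by auto
  then show ?thesis by (intro tuple_eqI) (auto simp: coord_swap_adj)
qed

section \<open>The representation\<close>

theorem theorem2p1: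
  fixes n :: nat and z :: "nat list" and X :: "nat list set"
    and scale :: "complex \<Rightarrow> 'v \<Rightarrow> 'v::ab_group_add"
    and ip :: "'v \<Rightarrow> 'v \<Rightarrow> complex"
    and v :: "nat list \<Rightarrow> 'v"
    and q :: "nat \<Rightarrow> nat \<Rightarrow> complex"
  assumes "n \<ge> 3" and "length z = n"
    and "X = rearrangements z"
    and "complex_inner_space scale ip"
    and "complex_inner_space.orthonormal_basis scale ip X v"
    and "\<And>x k. x \<in> X \<Longrightarrow> k \<in> {1..n - 1} \<Longrightarrow> q (coord x k) (coord x (k + 1)) \<noteq> 0"
  shows "\<exists>!\<phi>. \<phi> \<in> extensional (carrier (braid_group n)) \<and>
           fd_representation (braid_group n) scale \<phi> \<and>
           (\<forall>k\<in>{1..n - 1}. \<forall>x\<in>X.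
              \<phi> (braid_gen n k) (v x) =
                scale (q (coord x k) (coord x (k + 1))) (v (swap_adj k x)))"
proof -
  interpret complex_inner_space scale ip by (rule assms)
  note n = assms(1,2) and X = assms(3) and q = assms(6)
  have basis: "inj_on v X" "independent (v ` X)" "span (v ` X) = UNIV"
    using assms(5) by (simp_all add: orthonormal_basis_def)
  let ?K = "{1..n - 1}" and ?Q = "\<lambda>k x. q (coord x k) (coord x (k + 1))"
  let ?H = "Aut_group scale"
  have H: "group ?H" by (rule group_Aut_group) (rule vector_space_axioms)
  have len: "length x = n" if "x \<in> X" for x
    using that n mset_eq_length by (auto simp: X rearrangements_eq_mset)
  have s: "swap_adj k x \<in> X" if "k \<in> ?K" "x \<in> X" for k x
    using that n swap_adj_in_rearrangements unfolding X by blast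
  have ss: "swap_adj k (swap_adj k x) = x" if "k \<in> ?K" "x \<in> X" for k x
    using that len by (simp add: swap_adj_swap_adj)
  \<comment> \<open>No bound on \<open>k\<close> is imposed, so linearity of \<open>T k\<close> is
    available without side conditions; only bijectivity needs \<open>k\<close> in the index
    range.\<close>
  have "\<exists>T. Vector_Spaces.linear scale scale T \<and>
      (\<forall>x\<in>X. T (v x) = scale (?Q k x) (v (swap_adj k x)))" for k
    using linear_weighted_basis_map_exists[OF basis(1,2), of "?Q k" "swap_adj k"] by metis
  then obtain T where lin: "\<And>k. Vector_Spaces.linear scale scale (T k)"
    and T: "\<And>k x. x \<in> X \<Longrightarrow> T k (v x) = scale (?Q k x) (v (swap_adj k x))"
    by metis
  have T_scale: "T k (scale c w) = scale c (T k w)" for k c w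
  proof -
    interpret Vector_Spaces.linear scale scale "T k" by (rule lin)
    show ?thesis by (rule scale)
  qed
  have "bij (T k)" if "k \<in> ?K" for k
    using bij_weighted_basis_involution[OF basis, of "swap_adj k" "?Q k" "T k"] that s ss q lin T
    by blast
  then have T_Aut: "T \<in> ?K \<rightarrow> carrier ?H"
    using lin by (simp add: Aut_group_def)
  note lin_comp = Vector_Spaces.linear_compose[where ?s1.0 = scale and ?s2.0 = scale and ?s3.0 = scale]
  have commute: "T k \<circ> T j = T j \<circ> T k"
    if "k \<in> ?K" "j \<in> ?K" "\<bar>int k - int j\<bar> > 1" for k j
  proof (rule linear_eq_on_basis[OF _ _ basis(3)])
    fix b assume "b \<in> v ` X"
    then obtain x where x: "x \<in> X" "b = v x" by blast
    \<comment> \<open>The pairs \<open>k\<close>, \<open>k + 1\<close> and \<open>j\<close>,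
      \<open>j + 1\<close> are disjoint, so each scalar is the same before and after the other
      swap.\<close>
    then show "(T k \<circ> T j) b = (T j \<circ> T k) b"
      using that len[OF x(1)] swap_adj_commute[of k x j]
      by (auto simp: T T_scale s coord_swap_adj mult.commute)
  qed (intro lin lin_comp)+
  have braid: "T k \<circ> (T (k + 1) \<circ> T k) = T (k + 1) \<circ> (T k \<circ> T (k + 1))"
    if "k \<in> {1..n - 2}" for k
  proof (rule linear_eq_on_basis[OF _ _ basis(3)])
    fix b assume "b \<in> v ` X"
    then obtain x where x: "x \<in> X" "b = v x" by blast
    have k: "k \<in> ?K" "k + 1 \<in> ?K" using that by auto
    note l = len[OF x(1)]
    \<comment> \<open>On \<open>(a, b, c)\<close> both sides produce \<open>(c, b, a)\<close> with the factors
      \<open>q a b\<close>, \<open>q a c\<close>, \<open>q b c\<close>, in opposite orders.\<close>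
    have "(T k \<circ> (T (k + 1) \<circ> T k)) b =
      scale (q (coord x k) (coord x (k + 1)) * q (coord x k) (coord x (k + 2)) *
        q (coord x (k + 1)) (coord x (k + 2)))
        (v (swap_adj k (swap_adj (k + 1) (swap_adj k x))))"
      using k l x s by (simp add: T T_scale coord_swap_adj mult_ac)
    moreover have "(T (k + 1) \<circ> (T k \<circ> T (k + 1))) b =
      scale (q (coord x k) (coord x (k + 1)) * q (coord x k) (coord x (k + 2)) *
        q (coord x (k + 1)) (coord x (k + 2)))
        (v (swap_adj (k + 1) (swap_adj k (swap_adj (k + 1) x))))"
      using k l x s by (simp add: T T_scale coord_swap_adj mult_ac)
    ultimately show "(T k \<circ> (T (k + 1) \<circ> T k)) b = (T (k + 1) \<circ> (T k \<circ> T (k + 1))) b"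
      using swap_adj_braid[of k x] that l by simp
  qed (intro lin lin_comp)+
  \<comment> \<open>Relators contain positive letters only and multiplication in \<open>?H\<close>
    is composition, so the words evaluate to the right-nested composites in \<open>commute\<close>
    and \<open>braid\<close>.\<close>
  have rel: "word_eval ?H T u = word_eval ?H T w" if "(u, w) \<in> braid_relations n" for u w
    using that commute braid by (auto simp: braid_relations_def Aut_group_def)
  obtain \<phi> where \<phi>: "\<phi> \<in> hom (braid_group n) ?H"
    "\<phi> \<in> extensional (carrier (braid_group n))"
    "\<And>k. k \<in> ?K \<Longrightarrow> \<phi> (braid_gen n k) = T k"
    by (rule presented_group_hom_exists[OF H T_Aut, where R = "braid_relations n",
          folded braid_group_def braid_gen_def, OF rel]) (assumption, rule that)
  show ?thesis
  proof (rule ex1I[of _ \<phi>])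
    have "\<exists>B. finite B \<and> span B = UNIV"
      using basis(3) finite_rearrangements X by blast
    then show "\<phi> \<in> extensional (carrier (braid_group n)) \<and>
        fd_representation (braid_group n) scale \<phi> \<and>
        (\<forall>k\<in>?K. \<forall>x\<in>X. \<phi> (braid_gen n k) (v x) = scale (?Q k x) (v (swap_adj k x)))"
      using \<phi> T vector_space_axioms by (simp add: fd_representation_def)
  next
    fix \<psi>
    assume a: "\<psi> \<in> extensional (carrier (braid_group n)) \<and>
        fd_representation (braid_group n) scale \<psi> \<and>
        (\<forall>k\<in>?K. \<forall>x\<in>X. \<psi> (braid_gen n k) (v x) = scale (?Q k x) (v (swap_adj k x)))"
    then have \<psi>: "\<psi> \<in> hom (braid_group n) ?H" by (simp add: fd_representation_def)
    \<comment> \<open>Any competitor sends a generator to a linear map with the same values as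
      \<open>T k\<close> on the basis.\<close>
    have "\<psi> (braid_gen n k) = \<phi> (braid_gen n k)" if k: "k \<in> ?K" for k
    proof -
      have "\<psi> (braid_gen n k) \<in> carrier ?H"
        using \<psi> braid_gen_in_carrier[OF k] by (rule hom_in_carrier)
      then have "Vector_Spaces.linear scale scale (\<psi> (braid_gen n k))"
        by (simp add: Aut_group_def)
      then have "\<psi> (braid_gen n k) = T k"
        by (rule linear_eq_on_basis[OF _ lin basis(3)]) (use a k T in auto)
      then show ?thesis using \<phi>(3) k by simp
    qed
    then have "\<psi> A = \<phi> A" if "A \<in> carrier (braid_group n)" for A
      by (rule presented_group_hom_unique[OF H, where S = ?K and R = "braid_relations n",
            folded braid_group_def braid_gen_def, OF \<psi> \<phi>(1) _ that])
    then show "\<psi> = \<phi>" using extensionalityI[of \<psi> _ \<phi>] a \<phi>(2) by metis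
  qed
qed

end
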